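(* Let $\mathfrak{S}$ be a faithful cartesian club, $\mathcal{M}$ an $\mathfrak{S}$-multicategory, and $(A,\bullet)$ an applicative system in $\mathcal{M}$. Then $(A,\bullet)$ is $\mathfrak{S}$-combinatory complete if and only if the $(A,\bullet)$-computable morphisms form a sub-$\mathfrak{S}$-multicategory of $\mathcal{M}$ (with single object $A$).
   Context: Clubs. $\mathbf{Fun}$ is the category with objects the natural numbers and morphisms $n\to m$ the functions $\underline{n}\to\underline{m}$, where $\underline{n}=\{1,\ldots,n\}$. For $\mathbf{a}:n\to m$, $\mathbf{b}:h\to k$, $\mathbf{a}+\mathbf{b}:n+h\to m+k$ is $x\mapsto\mathbf{a}(x)$ for $x\le n$ and $x\mapsto\mathbf{b}(x-n)+m$ for $x>n$. For $\mathbf{a}:m\to n$ and $k_1,\ldots,k_n\in\mathbb{N}$, the wreath product $\mathbf{a}\wr(k_1,\ldots,k_n):\sum_{j=1}^m k_{\mathbf{a}(j)}\to\sum_{i=1}^n k_i$ sends the $p$-th element of the $j$-th block (of size $k_{\mathbf{a}(j)}$) to the $p$-th element of the $\mathbf{a}(j)$-th block. A faithful cartesian club is a subcategory $\mathfrak{S}$ of $\mathbf{Fun}$ containing all objects and closed under $+$ and under $\mathbf{a}\mapsto\mathbf{a}\wr(k_1,\ldots,k_n)$ for all $k_i$. Multicategories. A multicategory $\mathcal{M}$ has objects $\mathcal{M}_0$, morphism sets $\mathcal{M}(A_1,\ldots,A_n;B)$ ($n\ge 0$), identities $1_A\in\mathcal{M}(A;A)$, and associative unital composition sending $f\in\mathcal{M}(A_1,\ldots,A_n;B)$,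 $g_i\in\mathcal{M}(\Gamma_i;A_i)$ to $f\circ(g_1,\ldots,g_n)\in\mathcal{M}(\Gamma_1,\ldots,\Gamma_n;B)$. $A^n$ (resp. $f^n$) means $n$ copies of $A$ (resp. $f$). An $\mathfrak{S}$-multicategory is a multicategory with operations $[-]\mathbf{a}:\mathcal{M}(A_{\mathbf{a}(1)},\ldots,A_{\mathbf{a}(m)};B)\to\mathcal{M}(A_1,\ldots,A_n;B)$ for each $\mathbf{a}:m\to n$ in $\mathfrak{S}$, such that $[[f]\mathbf{a}]\mathbf{b}=[f](\mathbf{b}\circ\mathbf{a})$; $[f]1=f$; $g\circ([f_1]\mathbf{a}_1,\ldots,[f_n]\mathbf{a}_n)=[g\circ(f_1,\ldots,f_n)](\mathbf{a}_1+\cdots+\mathbf{a}_n)$; and $[g]\mathbf{a}\circ(f_1,\ldots,f_n)=[g\circ(f_{\mathbf{a}(1)},\ldots,f_{\mathbf{a}(m)})](\mathbf{a}\wr(k_1,\ldots,k_n))$ where $k_i$ is the arity of $f_i$. A sub-$\mathfrak{S}$-multicategory is given by subcollections of objects and of morphisms containing identities and closed under composition and under the action of $\mathfrak{S}$. Applicative systems. An applicative system $(A,\bullet)$ in $\mathcal{M}$ is an object $A$ with $\bullet\in\mathcal{M}(A,A;A)$. Put $\bullet^0=1_A$, $\bullet^{n+1}=\bullet\circ(\bullet^n,1_A)\in\mathcal{M}(A,A^{n+1};A)$. $f\in\mathcal{M}(A^n;A)$ is $(A,\bullet)$-computable if $f=\bullet^n\circ(a,1_A^n)$ for some $a\in\mathcal{M}(;A)$.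 $(A,\bullet)$ is $\mathfrak{S}$-combinatory complete if every morphism of the smallest sub-$\mathfrak{S}$-multicategory of $\mathcal{M}$ containing $\bullet$ and all $a\in\mathcal{M}(;A)$ is $(A,\bullet)$-computable. *)

theory Defs
  imports Main
begin

text \<open>
  The finite set with \<open>n\<close> elements is taken to be \<open>{0,\<dots>,n-1}\<close>, and a function from the \<open>m\<close>-element
  set to the \<open>n\<close>-element set is the list of its \<open>m\<close> values.  The codomain is not
  recorded in the list and is supplied separately where it matters.  A club \<open>S\<close> is given by its
  sets \<open>S m n\<close> of morphisms from \<open>m\<close> to \<open>n\<close>.
\<close>

definition fun_hom :: "nat \<Rightarrow> nat \<Rightarrow> nat list set" where
  "fun_hom m n = {a. length a = m \<and> set a \<subseteq> {..<n}}"

definition fun_id :: "nat \<Rightarrow> nat list" where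
  "fun_id n = [0..<n]"

definition fun_comp :: "nat list \<Rightarrow> nat list \<Rightarrow> nat list" where
  "fun_comp b a = map ((!) b) a"

text \<open>\<open>fun_plus m a b\<close> is \<open>a + b\<close> for \<open>a\<close> with codomain \<open>m\<close>.\<close>

definition fun_plus :: "nat \<Rightarrow> nat list \<Rightarrow> nat list \<Rightarrow> nat list" where
  "fun_plus m a b = a @ map (\<lambda>y. y + m) b"

text \<open>\<open>fun_Plus [n\<^sub>1,\<dots>,n\<^sub>r] [a\<^sub>1,\<dots>,a\<^sub>r]\<close> is \<open>a\<^sub>1 + \<dots> + a\<^sub>r\<close>, where \<open>a\<^sub>i\<close> has codomain \<open>n\<^sub>i\<close>.\<close>

fun fun_Plus :: "nat list \<Rightarrow> nat list list \<Rightarrow> nat list" where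
  "fun_Plus (n # ns) (a # as) = fun_plus n a (fun_Plus ns as)"
| "fun_Plus _ _ = []"

text \<open>The \<open>i\<close>-th block of the codomain starts at \<open>sum_list (take i ks)\<close> and has \<open>ks ! i\<close> elements;
  the \<open>j\<close>-th block of the domain is mapped identically onto the \<open>(a ! j)\<close>-th block of the codomain.\<close>

definition wreath :: "nat list \<Rightarrow> nat list \<Rightarrow> nat list" where
  "wreath a ks =
     concat (map (\<lambda>i. map (\<lambda>p. sum_list (take i ks) + p) [0..<ks ! i]) a)"

locale faithful_cartesian_club =
  fixes S :: "nat \<Rightarrow> nat \<Rightarrow> nat list set"
  assumes S_sub: "S m n \<subseteq> fun_hom m n"
    and S_id: "fun_id n \<in> S n n"
    and S_comp: "a \<in> S l m \<Longrightarrow> b \<in> S m n \<Longrightarrow> fun_comp b a \<in> S l n"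
    and S_plus: "a \<in> S n m \<Longrightarrow> b \<in> S h k \<Longrightarrow> fun_plus m a b \<in> S (n + h) (m + k)"
    and S_wreath: "a \<in> S m n \<Longrightarrow> length ks = n \<Longrightarrow>
      wreath a ks \<in> S (sum_list (map ((!) ks) a)) (sum_list ks)"

text \<open>
  Every morphism has one source (a list of objects) and one target, that is, the sets
  \<open>hom M \<Gamma> B\<close> of morphisms are disjoint for different \<open>(\<Gamma>, B)\<close>.
\<close>

record ('o, 'm) multicat =
  objs :: "'o set"
  mors :: "'m set"
  src :: "'m \<Rightarrow> 'o list"
  tgt :: "'m \<Rightarrow> 'o"
  idm :: "'o \<Rightarrow> 'm"
  mcomp :: "'m \<Rightarrow> 'm list \<Rightarrow> 'm"

definition hom :: "('o, 'm, 'z) multicat_scheme \<Rightarrow> 'o list \<Rightarrow> 'o \<Rightarrow> 'm set" where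
  "hom M \<Gamma> B = {f \<in> mors M. src M f = \<Gamma> \<and> tgt M f = B}"

definition composable :: "('o, 'm, 'z) multicat_scheme \<Rightarrow> 'm \<Rightarrow> 'm list \<Rightarrow> bool" where
  "composable M f gs \<longleftrightarrow> f \<in> mors M \<and> set gs \<subseteq> mors M \<and> map (tgt M) gs = src M f"

locale multicategory =
  fixes M :: "('o, 'm, 'z) multicat_scheme"
  assumes src_objs: "f \<in> mors M \<Longrightarrow> set (src M f) \<subseteq> objs M"
    and tgt_objs: "f \<in> mors M \<Longrightarrow> tgt M f \<in> objs M"
    and idm_hom: "B \<in> objs M \<Longrightarrow> idm M B \<in> hom M [B] B"
    and mcomp_hom: "composable M f gs \<Longrightarrow>
      mcomp M f gs \<in> hom M (concat (map (src M) gs)) (tgt M f)"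
    and mcomp_id_left: "f \<in> mors M \<Longrightarrow> mcomp M (idm M (tgt M f)) [f] = f"
    and mcomp_id_right: "f \<in> mors M \<Longrightarrow> mcomp M f (map (idm M) (src M f)) = f"
    and mcomp_assoc: "composable M f gs \<Longrightarrow> list_all2 (composable M) gs hss \<Longrightarrow>
      mcomp M (mcomp M f gs) (concat hss) = mcomp M f (map2 (mcomp M) gs hss)"

text \<open>
  \<open>act M \<Gamma> a f\<close> is \<open>[f]a\<close> regarded as a morphism with source \<open>\<Gamma>\<close>.  The list \<open>\<Gamma>\<close> is an argument
  because it is not determined by \<open>f\<close> and \<open>a\<close> when \<open>a\<close> is not surjective.
\<close>

record ('o, 'm) act_multicat = "('o, 'm) multicat" +
  act :: "'o list \<Rightarrow> nat list \<Rightarrow> 'm \<Rightarrow> 'm"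

definition actable ::
  "(nat \<Rightarrow> nat \<Rightarrow> nat list set) \<Rightarrow> ('o, 'm, 'z) multicat_scheme \<Rightarrow> 'o list \<Rightarrow> nat list \<Rightarrow> 'm \<Rightarrow> bool"
where
  "actable S M \<Gamma> a f \<longleftrightarrow> f \<in> mors M \<and> set \<Gamma> \<subseteq> objs M \<and>
     a \<in> S (length (src M f)) (length \<Gamma>) \<and> src M f = map ((!) \<Gamma>) a"

locale S_multicategory = faithful_cartesian_club S + multicategory M
  for S :: "nat \<Rightarrow> nat \<Rightarrow> nat list set" and M :: "('o, 'm, 'z) act_multicat_scheme" +
  assumes act_hom: "actable S M \<Gamma> a f \<Longrightarrow> act M \<Gamma> a f \<in> hom M \<Gamma> (tgt M f)"
    and act_act: "actable S M \<Gamma> a f \<Longrightarrow> set \<Delta> \<subseteq> objs M \<Longrightarrow>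
      b \<in> S (length \<Gamma>) (length \<Delta>) \<Longrightarrow> \<Gamma> = map ((!) \<Delta>) b \<Longrightarrow>
      act M \<Delta> b (act M \<Gamma> a f) = act M \<Delta> (fun_comp b a) f"
    and act_id: "f \<in> mors M \<Longrightarrow> act M (src M f) (fun_id (length (src M f))) f = f"
    and mcomp_act: "composable M g fs \<Longrightarrow> length \<Gamma>s = length fs \<Longrightarrow> length as = length fs \<Longrightarrow>
      (\<And>i. i < length fs \<Longrightarrow> actable S M (\<Gamma>s ! i) (as ! i) (fs ! i)) \<Longrightarrow>
      mcomp M g (map (\<lambda>i. act M (\<Gamma>s ! i) (as ! i) (fs ! i)) [0..<length fs]) =
      act M (concat \<Gamma>s) (fun_Plus (map length \<Gamma>s) as) (mcomp M g fs)"
    and act_mcomp: "actable S M \<Gamma> a g \<Longrightarrow> set fs \<subseteq> mors M \<Longrightarrow> map (tgt M) fs = \<Gamma> \<Longrightarrow>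
      mcomp M (act M \<Gamma> a g) fs =
      act M (concat (map (src M) fs)) (wreath a (map (\<lambda>f. length (src M f)) fs))
        (mcomp M g (map ((!) fs) a))"

definition sub_S_multicategory ::
  "(nat \<Rightarrow> nat \<Rightarrow> nat list set) \<Rightarrow> ('o, 'm, 'z) act_multicat_scheme \<Rightarrow> 'o set \<Rightarrow> 'm set \<Rightarrow> bool"
where
  "sub_S_multicategory S M Ob Mo \<longleftrightarrow>
     Ob \<subseteq> objs M \<and> Mo \<subseteq> mors M \<and>
     (\<forall>f\<in>Mo. set (src M f) \<subseteq> Ob \<and> tgt M f \<in> Ob) \<and>
     (\<forall>B\<in>Ob. idm M B \<in> Mo) \<and>
     (\<forall>f gs. f \<in> Mo \<and> set gs \<subseteq> Mo \<and> composable M f gs \<longrightarrow> mcomp M f gs \<in> Mo) \<and>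
     (\<forall>\<Gamma> a f. f \<in> Mo \<and> set \<Gamma> \<subseteq> Ob \<and> actable S M \<Gamma> a f \<longrightarrow> act M \<Gamma> a f \<in> Mo)"

text \<open>Objects and morphisms of the smallest sub-S-multicategory containing the morphisms in \<open>X\<close>.\<close>

definition gen_objs ::
  "(nat \<Rightarrow> nat \<Rightarrow> nat list set) \<Rightarrow> ('o, 'm, 'z) act_multicat_scheme \<Rightarrow> 'm set \<Rightarrow> 'o set" where
  "gen_objs S M X = \<Inter>{Ob. \<exists>Mo. sub_S_multicategory S M Ob Mo \<and> X \<subseteq> Mo}"

definition gen_mors ::
  "(nat \<Rightarrow> nat \<Rightarrow> nat list set) \<Rightarrow> ('o, 'm, 'z) act_multicat_scheme \<Rightarrow> 'm set \<Rightarrow> 'm set" where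
  "gen_mors S M X = \<Inter>{Mo. \<exists>Ob. sub_S_multicategory S M Ob Mo \<and> X \<subseteq> Mo}"

lemma (in S_multicategory) sub_S_multicategory_full:
  "sub_S_multicategory S M (objs M) (mors M)"
  using src_objs tgt_objs idm_hom mcomp_hom act_hom
  unfolding sub_S_multicategory_def hom_def by blast

lemma (in S_multicategory) sub_S_multicategory_gen:
  assumes "X \<subseteq> mors M"
  shows "sub_S_multicategory S M (gen_objs S M X) (gen_mors S M X)"
proof -
  have sub: "gen_objs S M X \<subseteq> objs M" "gen_mors S M X \<subseteq> mors M"
    using sub_S_multicategory_full assms unfolding gen_objs_def gen_mors_def by blast+
  have gen_le: "gen_objs S M X \<subseteq> Ob" "gen_mors S M X \<subseteq> Mo"
    if "sub_S_multicategory S M Ob Mo" "X \<subseteq> Mo" for Ob Mo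
    using that unfolding gen_objs_def gen_mors_def by blast+
  have "set (src M f) \<subseteq> gen_objs S M X \<and> tgt M f \<in> gen_objs S M X"
    if f: "f \<in> gen_mors S M X" for f
  proof -
    have "set (src M f) \<subseteq> Ob \<and> tgt M f \<in> Ob"
      if "sub_S_multicategory S M Ob Mo" "X \<subseteq> Mo" for Ob Mo
      using that gen_le[OF that] f by (auto simp: sub_S_multicategory_def)
    then show ?thesis unfolding gen_objs_def by blast
  qed
  moreover have "idm M B \<in> gen_mors S M X" if B: "B \<in> gen_objs S M X" for B
  proof -
    have "idm M B \<in> Mo" if "sub_S_multicategory S M Ob Mo" "X \<subseteq> Mo" for Ob Mo
      using that gen_le[OF that] B by (auto simp: sub_S_multicategory_def)
    then show ?thesis unfolding gen_mors_def by blast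
  qed
  moreover have "mcomp M f gs \<in> gen_mors S M X"
    if f: "f \<in> gen_mors S M X" "set gs \<subseteq> gen_mors S M X" "composable M f gs" for f gs
  proof -
    have "mcomp M f gs \<in> Mo" if "sub_S_multicategory S M Ob Mo" "X \<subseteq> Mo" for Ob Mo
    proof -
      have "f \<in> Mo" "set gs \<subseteq> Mo" using gen_le[OF that] f by auto
      then show ?thesis using that f(3) unfolding sub_S_multicategory_def by simp
    qed
    then show ?thesis unfolding gen_mors_def by blast
  qed
  moreover have "act M \<Gamma> a f \<in> gen_mors S M X"
    if f: "f \<in> gen_mors S M X" "set \<Gamma> \<subseteq> gen_objs S M X" "actable S M \<Gamma> a f" for \<Gamma> a f
  proof -
    have "act M \<Gamma> a f \<in> Mo" if "sub_S_multicategory S M Ob Mo" "X \<subseteq> Mo" for Ob Mo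
    proof -
      have "f \<in> Mo" "set \<Gamma> \<subseteq> Ob" using gen_le[OF that] f by auto
      then show ?thesis using that f(3) unfolding sub_S_multicategory_def by simp
    qed
    then show ?thesis unfolding gen_mors_def by blast
  qed
  ultimately show ?thesis
    using sub unfolding sub_S_multicategory_def by simp
qed

definition applicative_system :: "('o, 'm, 'z) multicat_scheme \<Rightarrow> 'o \<Rightarrow> 'm \<Rightarrow> bool" where
  "applicative_system M A app \<longleftrightarrow> A \<in> objs M \<and> app \<in> hom M [A, A] A"

primrec app_pow :: "('o, 'm, 'z) multicat_scheme \<Rightarrow> 'o \<Rightarrow> 'm \<Rightarrow> nat \<Rightarrow> 'm" where
  "app_pow M A app 0 = idm M A"
| "app_pow M A app (Suc n) = mcomp M app [app_pow M A app n, idm M A]"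

definition computable :: "('o, 'm, 'z) multicat_scheme \<Rightarrow> 'o \<Rightarrow> 'm \<Rightarrow> 'm \<Rightarrow> bool" where
  "computable M A app f \<longleftrightarrow> (\<exists>n. f \<in> hom M (replicate n A) A \<and>
     (\<exists>a \<in> hom M [] A. f = mcomp M (app_pow M A app n) (a # replicate n (idm M A))))"

definition combinatory_complete ::
  "(nat \<Rightarrow> nat \<Rightarrow> nat list set) \<Rightarrow> ('o, 'm, 'z) act_multicat_scheme \<Rightarrow> 'o \<Rightarrow> 'm \<Rightarrow> bool" where
  "combinatory_complete S M A app \<longleftrightarrow>
     (\<forall>f \<in> gen_mors S M (insert app (hom M [] A)). computable M A app f)"

end

theory Submission imports Defs begin

text \<open>
  Every computable morphism is built from \<open>\<bullet>\<close>, a constant and identities, so it lies in the generated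
  sub-S-multicategory; under combinatory completeness the two collections of morphisms therefore
  coincide.  Conversely, suppose the computable morphisms form a sub-S-multicategory.  Constants are
  always computable, so only \<open>\<bullet>\<close> has to be shown computable.  But \<open>1\<^sub>A\<close> is, which means
  \<open>i \<bullet> x = x\<close> for a constant \<open>i\<close>; hence \<open>(i \<bullet> x) \<bullet> y = x \<bullet> y\<close>, and the same \<open>i\<close> computes \<open>\<bullet>\<close>.
\<close>

context multicategory
begin

lemma app_pow_hom:
  assumes "applicative_system M A app"
  shows "app_pow M A app n \<in> hom M (replicate (Suc n) A) A"
proof (induction n)
  case 0
  then show ?case using assms idm_hom by (simp add: applicative_system_def)
next
  case (Suc n)
  have "composable M app [app_pow M A app n, idm M A]"
    using Suc assms idm_hom[of A]
    by (auto simp: composable_def hom_def applicative_system_def)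
  from mcomp_hom[OF this] show ?case
    using Suc assms idm_hom[of A]
    by (simp add: hom_def applicative_system_def replicate_append_same)
qed

lemma composable_app_pow:
  assumes "applicative_system M A app" and "a \<in> hom M [] A"
  shows "composable M (app_pow M A app n) (a # replicate n (idm M A))"
  using assms app_pow_hom[OF assms(1), of n] idm_hom[of A]
  by (auto simp: composable_def hom_def applicative_system_def)

text \<open>This is the recursion \<open>a \<bullet> x\<^sub>1 \<dots> x\<^sub>n x = (a \<bullet>
  x\<^sub>1 \<dots> x\<^sub>n) \<bullet> x\<close>, free of variables. It follows from associativity
  once the arguments are split between the two inputs of the outer \<open>app\<close>.\<close>

lemma mcomp_app_pow_Suc:
  assumes app: "applicative_system M A app" and a: "a \<in> hom M [] A"
  shows "mcomp M (app_pow M A app (Suc n)) (a # replicate (Suc n) (idm M A)) =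
    mcomp M app [mcomp M (app_pow M A app n) (a # replicate n (idm M A)), idm M A]"
proof -
  let ?I = "idm M A"
  have I: "?I \<in> mors M" "src M ?I = [A]" "tgt M ?I = A"
    using app idm_hom[of A] by (auto simp: hom_def applicative_system_def)
  have "composable M app [app_pow M A app n, ?I]"
    using app app_pow_hom[OF app, of n] I
    by (auto simp: composable_def hom_def applicative_system_def)
  \<comment> \<open>The constant and the first \<open>n\<close> identities feed the inner power; the
    last identity feeds the second input, where it is absorbed by the unit law.\<close>
  moreover have "list_all2 (composable M) [app_pow M A app n, ?I] [a # replicate n ?I, [?I]]"
    using composable_app_pow[OF app a] I by (simp add: composable_def)
  ultimately have "mcomp M (app_pow M A app (Suc n)) (concat [a # replicate n ?I, [?I]]) =
      mcomp M app (map2 (mcomp M) [app_pow M A app n, ?I] [a # replicate n ?I, [?I]])"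
    by (simp only: app_pow.simps mcomp_assoc)
  moreover have "mcomp M ?I [?I] = ?I"
    using mcomp_id_left[OF I(1)] I(3) by simp
  ultimately show ?thesis
    by (simp add: replicate_append_same)
qed

lemma mcomp_app_pow_0:
  assumes "a \<in> hom M [] A"
  shows "mcomp M (app_pow M A app 0) (a # replicate 0 (idm M A)) = a"
  using assms mcomp_id_left[of a] by (auto simp: hom_def)

text \<open>In arity 0 the power is the identity, so a constant computes itself.\<close>

lemma computable_const:
  assumes "a \<in> hom M [] A"
  shows "computable M A app a"
  using assms mcomp_app_pow_0[OF assms, of app, symmetric]
  unfolding computable_def by (metis replicate_0)

lemma computable_app:
  assumes app: "applicative_system M A app" and "computable M A app (idm M A)"
  shows "computable M A app app"
proof -
  have I: "idm M A \<in> hom M [A] A"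
    using app idm_hom by (simp add: applicative_system_def)
  obtain n i where i: "i \<in> hom M [] A"
    and n: "idm M A \<in> hom M (replicate n A) A"
    and idm: "idm M A = mcomp M (app_pow M A app n) (i # replicate n (idm M A))"
    using assms(2) unfolding computable_def by blast
  \<comment> \<open>The arity in \<open>computable\<close> is existential; comparing the sources
    \<open>[A]\<close> and \<open>replicate n A\<close> fixes it.\<close>
  have "n = Suc 0"
    using I n by (cases n) (auto simp: hom_def)
  then have "mcomp M (app_pow M A app 2) (i # replicate 2 (idm M A)) =
      mcomp M app [idm M A, idm M A]"
    using mcomp_app_pow_Suc[OF app i, of 1] idm by (simp add: numeral_2_eq_2)
  also have "\<dots> = app"
    using app mcomp_id_right[of app] by (auto simp: hom_def applicative_system_def)
  finally have "app = mcomp M (app_pow M A app 2) (i # replicate 2 (idm M A))" ..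
  moreover have "app \<in> hom M (replicate 2 A) A"
    using app by (simp add: applicative_system_def numeral_2_eq_2)
  ultimately show ?thesis
    using i unfolding computable_def by blast
qed

end

lemma computable_in_sub_S_multicategory:
  assumes sub: "sub_S_multicategory S M Ob Mo"
    and "multicategory M" and app: "applicative_system M A app"
    and gen: "insert app (hom M [] A) \<subseteq> Mo" and "computable M A app f"
  shows "f \<in> Mo"
proof -
  interpret multicategory M by fact
  have comp: "mcomp M g gs \<in> Mo" if "g \<in> Mo" "set gs \<subseteq> Mo" "composable M g gs" for g gs
    using sub that unfolding sub_S_multicategory_def by blast
  \<comment> \<open>\<open>Ob\<close> is arbitrary, so that it contains \<open>A\<close> has to be
    read off from the source of \<open>app\<close>; only then is the identity of \<open>A\<close>
    known to lie in \<open>Mo\<close>.\<close>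
  have "set (src M app) \<subseteq> Ob"
    using sub gen by (auto simp: sub_S_multicategory_def)
  then have "A \<in> Ob"
    using app by (simp add: applicative_system_def hom_def)
  then have I: "idm M A \<in> Mo"
    using sub by (simp add: sub_S_multicategory_def)
  obtain n a where a: "a \<in> hom M [] A"
    and f: "f = mcomp M (app_pow M A app n) (a # replicate n (idm M A))"
    using \<open>computable M A app f\<close> unfolding computable_def by blast
  have pow: "app_pow M A app k \<in> Mo" for k
  proof (induction k)
    case (Suc k)
    have "composable M app [app_pow M A app k, idm M A]"
      using app app_pow_hom[OF app, of k] idm_hom[of A]
      by (auto simp: composable_def hom_def applicative_system_def)
    then show ?case using Suc I gen by (auto intro!: comp)
  qed (use I in simp)
  show ?thesis
    unfolding f using pow a gen I by (intro comp composable_app_pow[OF app a]) auto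
qed

theorem theorem4p10:
  fixes S :: "nat \<Rightarrow> nat \<Rightarrow> nat list set"
    and M :: "('o, 'm) act_multicat"
    and A :: 'o and app :: 'm
  assumes "faithful_cartesian_club S"
    and "S_multicategory S M"
    and "applicative_system M A app"
  shows "combinatory_complete S M A app \<longleftrightarrow>
    sub_S_multicategory S M {A} {f. computable M A app f}"
proof -
  interpret S_multicategory S M by fact
  note app = assms(3)
  define X where "X = insert app (hom M [] A)"
  have "X \<subseteq> mors M"
    using app by (auto simp: X_def applicative_system_def hom_def)
  note gen = sub_S_multicategory_gen[OF this]
  have X_gen: "X \<subseteq> gen_mors S M X"
    unfolding gen_mors_def by blast
  have A: "A \<in> objs M" "A \<in> gen_objs S M X"
    using app X_gen gen
    by (auto simp: applicative_system_def sub_S_multicategory_def hom_def X_def)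
  show ?thesis
  proof
    assume "combinatory_complete S M A app"
    then have eq: "{f. computable M A app f} = gen_mors S M X"
      using computable_in_sub_S_multicategory[OF gen multicategory_axioms app] X_gen
      unfolding combinatory_complete_def X_def by blast
    \<comment> \<open>The morphism sets agree, but closure is known over
      \<open>gen_objs S M X\<close>. To pass to the single object \<open>A\<close>, sources and
      targets are bounded through computability, while lists over \<open>{A}\<close> are lists over
      the generated objects.\<close>
    have "set (src M f) \<subseteq> {A} \<and> tgt M f \<in> {A}" if "f \<in> gen_mors S M X" for f
    proof -
      have "computable M A app f" using that eq by blast
      then show ?thesis by (auto simp: computable_def hom_def)
    qed
    moreover have "set \<Gamma> \<subseteq> gen_objs S M X" if "set \<Gamma> \<subseteq> {A}" for \<Gamma>
      using that A by blast
    ultimately show "sub_S_multicategory S M {A} {f. computable M A app f}"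
      using gen A unfolding eq sub_S_multicategory_def by simp
  next
    assume sub: "sub_S_multicategory S M {A} {f. computable M A app f}"
    then have "computable M A app (idm M A)"
      by (simp add: sub_S_multicategory_def)
    then have "X \<subseteq> {f. computable M A app f}"
      using computable_app[OF app] computable_const by (auto simp: X_def)
    \<comment> \<open>The computable morphisms are now one of the collections being
      intersected.\<close>
    then have "gen_mors S M X \<subseteq> {f. computable M A app f}"
      using sub unfolding gen_mors_def by blast
    then show "combinatory_complete S M A app"
      unfolding combinatory_complete_def X_def by blast
  qed
qed

end
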